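(* Let $X$ be a finite set with $|X|=n$, let $T$ be an integer with $1\le T\le n$, and let $f\colon 2^X\to\mathbb{R}_+$ be a nondecreasing submodular set function with $f(\emptyset)=0$ whose total curvature $\alpha$ satisfies $\alpha\in(0,1]$. Let $S_{opt}$ be an optimal solution, and $S_{gr}$ a greedy solution, to the problem $$\max\{f(S)\colon |S|=T,\ S\subset X\},$$ and let $m=|S_{opt}\cap S_{gr}|$. Then $$\frac{f(S_{gr})}{f(S_{opt})}\ \ge\ G(T,\alpha,m)\ \ge\ \widetilde{G}(T,\alpha,n),$$ where $$G(T,\alpha,m)=\frac{1}{\alpha}\left(1-\left(1-\frac{\alpha m}{T}\right)\left(1-\frac{\alpha}{T}\right)^{T-m}\right),\qquad \widetilde{G}(T,\alpha,n)=G(T,\alpha,\max\{0,2T-n\}).$$ Moreover, these bounds are tight in the following sense: for every $\alpha\in(0,1]$ and all integers $n$ and $T$ with $1\le T\le n$, there exist a set $X$ with $|X|=n$, a nondecreasing submodular function $f\colon 2^X\to\mathbb{R}_+$ with $f(\emptyset)=0$ and total curvature $\alpha$, an optimal solution $S_{opt}$ and a greedy solution $S_{gr}$ to the problem $\max\{f(S)\colon |S|=T,\ S\subset X\}$ such that $|S_{opt}\cap S_{gr}|=\max\{0,2T-n\}$ and $$\frac{f(S_{gr})}{f(S_{opt})}=\widetilde{G}(T,\alpha,n).$$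
   Context: Let $X$ be a finite set. A set function $f\colon 2^X\to\mathbb{R}_+$ (values in the nonnegative reals) is submodular if $f(S)+f(R)\ge f(S\cup R)+f(S\cap R)$ for all $S,R\subset X$, and nondecreasing if $f(S)\le f(R)$ whenever $S\subset R\subset X$. The symbol $\subset$ allows equality. The total curvature of a nondecreasing submodular $f$ (not identically zero) with $f(\emptyset)=0$ is $$\alpha=\max\left\{1-\frac{f(X)-f(X\setminus\{x\})}{f(\{x\})-f(\emptyset)}\colon x\in X,\ f(\{x\})\ne f(\emptyset)\right\}\in[0,1].$$ An optimal solution to $\max\{f(S)\colon |S|=T,\ S\subset X\}$ is a set $S_{opt}\subset X$ with $|S_{opt}|=T$ attaining the maximum. A greedy solution $S_{gr}$ is any possible output of the following greedy algorithm (ties broken arbitrarily): put $S_0=\emptyset$; for $t=1,\dots,T$ select any $x_t\in X\setminus S_{t-1}$ with $$f(S_{t-1}\cup\{x_t\})=\max\{f(S_{t-1}\cup\{x\})\colon x\in X\setminus S_{t-1}\}$$ and set $S_t=S_{t-1}\cup\{x_t\}$; finally $S_{gr}=S_T$. Convention: an expression raised to the power $0$ equals $1$.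
   Formalization: The tightness claim is stated for n ≥ 2 only: for n = T = 1 it is false, since a nonzero f on a one-element X with f(∅)=0 always has total curvature 0, so no α in (0,1] is attained. *)

theory Defs
  imports Complex_Main
begin

definition submodular_on :: "'a set \<Rightarrow> ('a set \<Rightarrow> real) \<Rightarrow> bool" where
  "submodular_on X f \<longleftrightarrow>
     (\<forall>S R. S \<subseteq> X \<longrightarrow> R \<subseteq> X \<longrightarrow> f S + f R \<ge> f (S \<union> R) + f (S \<inter> R))"

text \<open>
  A set function on the subsets of \<open>X\<close> is a function on all sets of which only the values on
  \<open>Pow X\<close> matter. The predicate collects: nonnegative, nondecreasing, submodular, zero on the
  empty set, and not identically zero. The last condition guarantees that the maximum defining the
  total curvature is taken over a nonempty set (\<open>Max {}\<close> is an unspecified number).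
\<close>

definition nondecreasing_submodular :: "'a set \<Rightarrow> ('a set \<Rightarrow> real) \<Rightarrow> bool" where
  "nondecreasing_submodular X f \<longleftrightarrow>
     (\<forall>S\<subseteq>X. 0 \<le> f S) \<and> mono_on (Pow X) f \<and> submodular_on X f \<and>
     f {} = 0 \<and> (\<exists>S\<subseteq>X. f S \<noteq> 0)"

definition total_curvature :: "'a set \<Rightarrow> ('a set \<Rightarrow> real) \<Rightarrow> real" where
  "total_curvature X f =
     Max {1 - (f X - f (X - {x})) / (f {x} - f {}) | x. x \<in> X \<and> f {x} \<noteq> f {}}"

definition optimal_solution :: "'a set \<Rightarrow> ('a set \<Rightarrow> real) \<Rightarrow> nat \<Rightarrow> 'a set \<Rightarrow> bool" where
  "optimal_solution X f T S \<longleftrightarrow> is_arg_max f (\<lambda>R. R \<subseteq> X \<and> card R = T) S"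

text \<open>\<open>greedy_solution X f t S\<close>: the set \<open>S\<close> is a possible state of the greedy algorithm after
  \<open>t\<close> steps, under some way of breaking ties.\<close>

inductive greedy_solution :: "'a set \<Rightarrow> ('a set \<Rightarrow> real) \<Rightarrow> nat \<Rightarrow> 'a set \<Rightarrow> bool"
  for X :: "'a set" and f :: "'a set \<Rightarrow> real" where
  start: "greedy_solution X f 0 {}"
| step: "greedy_solution X f t S \<Longrightarrow> is_arg_max (\<lambda>y. f (S \<union> {y})) (\<lambda>y. y \<in> X - S) x
    \<Longrightarrow> greedy_solution X f (Suc t) (S \<union> {x})"

text \<open>The exponent is a truncated difference; it is only used for \<open>m \<le> T\<close>.\<close>

definition bound_G :: "nat \<Rightarrow> real \<Rightarrow> nat \<Rightarrow> real" where
  "bound_G T \<alpha> m =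
     1 / \<alpha> * (1 - (1 - \<alpha> * real m / real T) * (1 - \<alpha> / real T) ^ (T - m))"

text \<open>Truncated subtraction of naturals gives \<open>2 * T - n = max {0, 2T - n}\<close>.\<close>

definition bound_G_tilde :: "nat \<Rightarrow> real \<Rightarrow> nat \<Rightarrow> real" where
  "bound_G_tilde T \<alpha> n = bound_G T \<alpha> (2 * T - n)"

text \<open>On a one-element ground set the total curvature is always 0, so a positive total curvature
  can only be attained on ground sets with at least two elements.\<close>

lemma total_curvature_singleton:
  assumes "nondecreasing_submodular X f" and "card X = 1"
  shows "total_curvature X f = 0"
proof -
  obtain a where X: "X = {a}" using assms(2) by (auto simp: card_1_singleton_iff)
  have e: "f {} = 0" and "\<exists>S\<subseteq>X. f S \<noteq> 0"
    using assms(1) by (auto simp: nondecreasing_submodular_def)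
  then have n: "f {a} \<noteq> 0" unfolding X by (metis subset_singletonD)
  have "{1 - (f X - f (X - {x})) / (f {x} - f {}) | x. x \<in> X \<and> f {x} \<noteq> f {}} = {0}"
    using e n unfolding X by auto
  then show ?thesis unfolding total_curvature_def by simp
qed

end

theory Submission imports Defs begin

text \<open>
  Let \<open>a\<^sub>t\<close> be the gain of greedy step \<open>t\<close> and \<open>S\<^sub>t\<close> the greedy set before it. Bounding
  \<open>f (S_opt \<union> S\<^sub>t)\<close> from below by the curvature and from above by the greedy choice gives
  \<open>f S_opt \<le> (\<Sum>i<t. a\<^sub>i or \<alpha> a\<^sub>i) + \<bar>S_opt - S\<^sub>t\<bar> a\<^sub>t\<close>, where the coefficient \<open>\<alpha>\<close> is used for the
  elements outside \<open>S_opt\<close> (as in Conforti and Cornuejols). Among all sequences satisfying these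
  inequalities, the sum is smallest when all inequalities are tight and the steps that pick
  elements of \<open>S_opt\<close> come last; the sum is then \<open>G\<close>. Monotonicity of \<open>G\<close> in \<open>m\<close> and
  \<open>m \<ge> 2 T - n\<close> give the second bound. Tightness is witnessed by \<open>f = A + B - \<alpha> A B\<close> with modular
  functions \<open>A\<close> and \<open>B\<close> of disjoint supports, where \<open>A\<close> has geometrically decreasing weights chosen
  so that the greedy algorithm always faces a tie.
\<close>

section \<open>Analysis of the recursion\<close>

text \<open>Decouples the parameters of \<open>bound_G\<close>: \<open>j\<close> steps outside and
  \<open>c\<close> steps inside the optimum, while \<open>k\<close> of its elements are still
  missing. This lets an induction peel off single steps. For \<open>k = 0\<close>, division by zero
  makes the value 0.\<close>

definition opt_ratio :: "real \<Rightarrow> nat \<Rightarrow> nat \<Rightarrow> nat \<Rightarrow> real" where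
  "opt_ratio \<alpha> k j c = 1 / \<alpha> * (1 - (1 - \<alpha> * real c / real k) * (1 - \<alpha> / real k) ^ j)"

lemma bound_G_eq_opt_ratio: "bound_G T \<alpha> m = opt_ratio \<alpha> T (T - m) m"
  by (simp add: bound_G_def opt_ratio_def)

text \<open>Bernoulli's inequality bounds the subtracted product below by
  \<open>1 - \<alpha> * (j + c) / k\<close>, hence by \<open>1 - \<alpha>\<close>. The bounds keep
  the factors \<open>1 - \<alpha> * W\<close> and \<open>1 - W\<close> of the later induction
  nonnegative.\<close>

lemma opt_ratio_bounds:
  assumes "0 < \<alpha>" "\<alpha> \<le> 1" "j + c \<le> k"
  shows "0 \<le> opt_ratio \<alpha> k j c" "opt_ratio \<alpha> k j c \<le> 1"
proof -
  define u where "u = \<alpha> * real c / real k"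
  define q where "q = (1 - \<alpha> / real k) ^ j"
  have k: "\<alpha> * real i / real k \<le> \<alpha>" if "i \<le> k" for i
    using that assms(1) by (cases "k = 0") (auto simp: field_simps)
  have u: "0 \<le> u" "u \<le> 1" unfolding u_def using k[of c] assms by auto
  have ak: "\<alpha> / real k \<le> 1" using assms k[of 1] by (cases "k = 0") auto
  have q: "0 \<le> q" "q \<le> 1" unfolding q_def using ak assms by (auto intro!: power_le_one)
  have "1 - \<alpha> * real j / real k \<le> q"
    unfolding q_def using Bernoulli_inequality[of "- (\<alpha> / real k)" j] ak
    by (simp add: algebra_simps)
  then have "(1 - u) * (1 - \<alpha> * real j / real k) \<le> (1 - u) * q"
    using u by (intro mult_left_mono) auto
  moreover have "1 - (u + w) \<le> (1 - u) * (1 - w)" if "0 \<le> w" for w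
    using mult_nonneg_nonneg[OF u(1) that] by (simp add: algebra_simps)
  then have "1 - (u + \<alpha> * real j / real k) \<le> (1 - u) * (1 - \<alpha> * real j / real k)"
    using assms(1) by simp
  moreover have "u + \<alpha> * real j / real k \<le> \<alpha>"
    using k[of "j + c"] assms by (simp add: u_def algebra_simps add_divide_distrib)
  ultimately have 1: "1 - (1 - u) * q \<le> \<alpha>" by linarith
  have 2: "(1 - u) * q \<le> 1" using u q by (simp add: mult_le_one)
  have e: "opt_ratio \<alpha> k j c = (1 - (1 - u) * q) / \<alpha>"
    by (simp add: opt_ratio_def u_def q_def)
  show "0 \<le> opt_ratio \<alpha> k j c" "opt_ratio \<alpha> k j c \<le> 1"
    unfolding e using 1 2 assms(1) by auto
qed

text \<open>A tight first step outside the optimum gains \<open>1 / k\<close> and leaves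
  \<open>1 - \<alpha> / k\<close> of the unit, on which the ratio for \<open>j\<close> is then
  earned.\<close>

lemma opt_ratio_private_step:
  assumes "0 < \<alpha>" "0 < k"
  shows "opt_ratio \<alpha> k (Suc j) c
    = opt_ratio \<alpha> k j c + 1 / real k * (1 - \<alpha> * opt_ratio \<alpha> k j c)"
  using assms by (simp add: opt_ratio_def field_simps)

text \<open>The sum of the tight gains for an optimum of value \<open>k\<close>: those of the
  \<open>j\<close> outside steps decay geometrically, and the \<open>c\<close> final ones stay at
  the level reached.\<close>

lemma opt_ratio_geometric:
  assumes "0 < \<alpha>" "0 < k"
  shows "real k * opt_ratio \<alpha> k j c
    = (\<Sum>i<j. (1 - \<alpha> / real k) ^ i) + real c * (1 - \<alpha> / real k) ^ j"
proof (induction j)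
  case 0
  then show ?case using assms by (simp add: opt_ratio_def)
next
  case (Suc j)
  have "real k * opt_ratio \<alpha> k (Suc j) c
    = (real k * opt_ratio \<alpha> k j c) * (1 - \<alpha> / real k) + 1"
    using assms by (simp add: opt_ratio_private_step field_simps)
  also have "\<dots> = (\<Sum>i<Suc j. (1 - \<alpha> / real k) ^ i) + real c * (1 - \<alpha> / real k) ^ Suc j"
    unfolding Suc.IH sum.lessThan_Suc_shift by (simp add: algebra_simps sum_distrib_left)
  finally show ?case .
qed

text \<open>A mean value bound, by Bernoulli for \<open>p / q\<close>; its form avoids the exponent
  \<open>i - 1\<close>.\<close>

lemma power_diff_le:
  fixes p q :: real
  assumes "0 \<le> p" "p \<le> q" "0 < q"
  shows "q ^ i - p ^ i \<le> real i * (q ^ i * ((q - p) / q))"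
proof -
  have "1 + real i * (p / q - 1) \<le> (1 + (p / q - 1)) ^ i"
    using assms by (intro Bernoulli_inequality) auto
  then have "q ^ i * (1 + real i * (p / q - 1)) \<le> q ^ i * (p / q) ^ i"
    using assms by (intro mult_left_mono) auto
  also have "\<dots> = p ^ i" using assms by (simp add: power_divide)
  finally show ?thesis using assms by (simp add: field_simps)
qed

text \<open>Scheduling a step that picks an element of the optimal set before the other steps cannot
  make the outcome worse.\<close>

lemma opt_ratio_common_step:
  assumes a: "0 < \<alpha>" "\<alpha> \<le> 1" and jc: "j + Suc c \<le> Suc k"
  shows "real (Suc k) * opt_ratio \<alpha> (Suc k) j (Suc c) \<le> 1 + real k * opt_ratio \<alpha> k j c"
proof (cases "j = 0")
  case True
  then show ?thesis using a jc by (cases "k = 0") (auto simp: opt_ratio_def)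
next
  case False
  then have k: "0 < k" using jc by simp
  define q where "q = 1 - \<alpha> / real (Suc k)"
  define p where "p = 1 - \<alpha> / real k"
  define d where "d = \<alpha> / (real k * real (Suc k))"
  have d: "q - p = d" "0 < d"
    using a k by (simp_all add: q_def p_def d_def divide_simps) (simp add: algebra_simps)?
  have kq: "real k - 1 \<le> real k * q"
    using a mult_right_mono[OF a(2), of "real k"] by (simp add: q_def field_simps)
  have p0: "0 \<le> p" using a k by (simp add: p_def field_simps)
  have q1: "q < 1" using a by (simp add: q_def)
  have q0: "0 < q" using p0 d by linarith
  have dq: "1 - q = real k * d" using k by (simp add: q_def d_def)
  \<comment> \<open>By the geometric form the claim becomes
    \<open>c * (q ^ j - p ^ j) \<le> (\<Sum>i<j. p ^ i - q ^ Suc i)\<close>. The left side is at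
    most \<open>j\<close> copies of the quantity bounded here, so a termwise comparison suffices. It
    rests on \<open>c + i \<le> k - 1 \<le> k * q\<close>.\<close>
  have t: "real c * (q ^ j * (d / q)) \<le> p ^ i - q ^ Suc i" if "i < j" for i
  proof -
    have "q ^ i - p ^ i \<le> real i * (q ^ i * (d / q))"
      using power_diff_le[of p q i] p0 q0 d by simp
    moreover have "q ^ i - q ^ Suc i = (1 - q) * q ^ i" by (simp add: algebra_simps)
    then have "q ^ i - q ^ Suc i = (real k * q) * (q ^ i * (d / q))"
      using q0 by (simp add: dq)
    moreover have "(real c + real i) * (q ^ i * (d / q)) \<le> (real k * q) * (q ^ i * (d / q))"
      using that jc kq q0 d by (intro mult_right_mono) auto
    moreover have "real c * (q ^ j * (d / q)) \<le> real c * (q ^ i * (d / q))"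
      using that q0 q1 d by (intro mult_left_mono mult_right_mono power_decreasing) auto
    ultimately show ?thesis unfolding distrib_right by linarith
  qed
  have "real c * (q ^ j - p ^ j) \<le> real c * (real j * (q ^ j * (d / q)))"
    using power_diff_le[of p q j] p0 q0 d by (intro mult_left_mono) auto
  also have "\<dots> = (\<Sum>i<j. real c * (q ^ j * (d / q)))" by simp
  also have "\<dots> \<le> (\<Sum>i<j. p ^ i - q ^ Suc i)" using t by (intro sum_mono) auto
  also have "\<dots> = (\<Sum>i<j. p ^ i) - (\<Sum>i<j. q ^ i) + 1 - q ^ j"
  proof -
    have "(\<Sum>i<j. q ^ Suc i) = (\<Sum>i<j. q ^ i) - 1 + q ^ j"
      by (induction j) auto
    then show ?thesis by (simp add: sum_subtractf)
  qed
  finally have "(\<Sum>i<j. q ^ i) + real (Suc c) * q ^ j \<le> 1 + ((\<Sum>i<j. p ^ i) + real c * p ^ j)"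
    by (simp add: algebra_simps)
  then show ?thesis
    using opt_ratio_geometric[OF a(1), of "Suc k" j "Suc c"] opt_ratio_geometric[OF a(1) k, of j c]
    unfolding q_def p_def by simp
qed

section \<open>Sequences obeying the greedy inequalities\<close>

lemma card_less_Suc_shift:
  "card {i. i < Suc t \<and> P i} = (if P 0 then 1 else 0) + card {i. i < t \<and> P (Suc i)}"
proof -
  have "{i. i < Suc t \<and> P i} = (if P 0 then {0} else {}) \<union> Suc ` {i. i < t \<and> P (Suc i)}"
    by (auto simp: less_Suc_eq_0_disj)
  moreover have "card \<dots> = card (if P 0 then {0::nat} else {}) + card (Suc ` {i. i < t \<and> P (Suc i)})"
    by (intro card_Un_disjoint) auto
  ultimately show ?thesis by (auto simp: card_image)
qed

text \<open>The greedy recursion: \<open>R\<close> is the part of the optimum not yet accounted for, \<open>k\<close> the number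
  of elements of the optimal set still missing, and \<open>P i\<close> says that step \<open>i\<close> picks one of these.\<close>

lemma sum_ge_opt_ratio:
  fixes a :: "nat \<Rightarrow> real"
  assumes "0 < \<alpha>" "\<alpha> \<le> 1"
    and "N \<le> k"
    and "\<And>i. i < N \<Longrightarrow> 0 \<le> a i"
    and "\<And>t. t < N \<Longrightarrow> R \<le> (\<Sum>i<t. if P i then a i else \<alpha> * a i)
                + (real k - real (card {i. i < t \<and> P i})) * a t"
  defines "c \<equiv> \<lambda>N P. card {i. i < N \<and> P i}"
  shows "R * opt_ratio \<alpha> k (N - c N P) (c N P) \<le> (\<Sum>i<N. a i)"
  using assms(3-5)
proof (induction N arbitrary: k P a R)
  case 0
  then show ?case by (simp add: c_def opt_ratio_def)
next
  case (Suc N)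
  define c' where "c' = c N (\<lambda>i. P (Suc i))"
  have c'N: "c' \<le> N" using card_mono[of "{..<N}" "{i. i < N \<and> P (Suc i)}"]
    by (auto simp: c'_def c_def)
  have cS: "c (Suc N) P = (if P 0 then 1 else 0) + c'"
    unfolding c_def c'_def by (rule card_less_Suc_shift)
  have a0: "R \<le> real k * a 0" using Suc.prems(3)[of 0] by simp
  have sum0: "0 \<le> (\<Sum>i<N. a (Suc i))" using Suc.prems(2) by (intro sum_nonneg) auto
  have pos: "0 \<le> a 0" using Suc.prems(2) by auto
  have k: "0 < k" using Suc.prems(1) by auto
  \<comment> \<open>The shifted sequence obeys the same system: \<open>R\<close> drops by what the
    first step accounts for, and \<open>k\<close> drops exactly when that step picks from the
    optimum.\<close>
  have rest: "R - (if P 0 then a 0 else \<alpha> * a 0) \<le> (\<Sum>i<t. if P (Suc i) then a (Suc i) else \<alpha> * a (Suc i))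
        + (real k - (if P 0 then 1 else 0) - real (card {i. i < t \<and> P (Suc i)})) * a (Suc t)"
    if "t < N" for t
    using Suc.prems(3)[of "Suc t"] that
    by (simp add: sum.lessThan_Suc_shift card_less_Suc_shift del: sum.lessThan_Suc split: if_splits)
      (simp add: algebra_simps)?
  show ?case
  proof (cases "P 0")
    case False
    have IH: "(R - \<alpha> * a 0) * opt_ratio \<alpha> k (N - c') c' \<le> (\<Sum>i<N. a (Suc i))"
      unfolding c'_def using Suc.prems rest False by (intro Suc.IH) auto
    define W where "W = opt_ratio \<alpha> k (N - c') c'"
    have "W \<le> 1" "0 \<le> W" unfolding W_def using opt_ratio_bounds assms(1,2) Suc.prems(1) c'N by auto
    then have aW: "\<alpha> * W \<le> 1" using assms(1,2) by (simp add: mult_le_one)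
    have step: "opt_ratio \<alpha> k (Suc N - c') c' = W + 1 / real k * (1 - \<alpha> * W)"
      unfolding W_def using opt_ratio_private_step[OF assms(1) k] c'N by (simp add: Suc_diff_le)
    have "R * opt_ratio \<alpha> k (Suc N - c') c' = R * W + R / real k * (1 - \<alpha> * W)"
      unfolding step by (simp add: distrib_left)
    \<comment> \<open>The constraint for \<open>t = 0\<close> says
      \<open>R / k \<le> a 0\<close>.\<close>
    also have "\<dots> \<le> R * W + a 0 * (1 - \<alpha> * W)"
      using aW a0 k by (intro add_left_mono mult_right_mono) (auto simp: field_simps)
    also have "\<dots> = a 0 + (R - \<alpha> * a 0) * W" by (simp add: algebra_simps)
    also have "\<dots> \<le> (\<Sum>i<Suc N. a i)"
      using IH by (simp add: W_def sum.lessThan_Suc_shift del: sum.lessThan_Suc)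
    finally show ?thesis using cS False by simp
  next
    case True
    obtain k' where k': "k = Suc k'" using k by (cases k) auto
    define W where "W = opt_ratio \<alpha> k' (N - c') c'"
    define V where "V = opt_ratio \<alpha> k (N - c') (Suc c')"
    have IH: "(R - a 0) * W \<le> (\<Sum>i<N. a (Suc i))"
      unfolding c'_def W_def using Suc.prems rest True k' by (intro Suc.IH) auto
    have W: "W \<le> 1" "0 \<le> W"
      unfolding W_def using opt_ratio_bounds assms(1,2) Suc.prems(1) c'N k' by auto
    have V: "0 \<le> V" unfolding V_def using opt_ratio_bounds assms(1,2) Suc.prems(1) c'N k' by auto
    have VW: "real k * V \<le> 1 + real k' * W"
      unfolding V_def W_def k' using assms(1,2) Suc.prems(1) c'N k' by (intro opt_ratio_common_step) auto
    have "R * V \<le> a 0 + (\<Sum>i<N. a (Suc i))"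
    \<comment> \<open>Earlier subtractions may have made \<open>R\<close> nonpositive; the claim is
      then trivial. Otherwise \<open>VW\<close> can be scaled by \<open>R / k\<close>.\<close>
    proof (cases "R \<le> 0")
      case True
      then show ?thesis using mult_nonpos_nonneg[OF True V] sum0 pos by linarith
    next
      case False
      have "R * V = R / real k * (real k * V)" using k by simp
      also have "\<dots> \<le> R / real k * (1 + real k' * W)"
        using VW False k by (intro mult_left_mono) auto
      also have "\<dots> = R * W + R / real k * (1 - W)" using k' by (simp add: field_simps)
      also have "\<dots> \<le> R * W + a 0 * (1 - W)"
        using W a0 k by (intro add_left_mono mult_right_mono) (auto simp: field_simps)
      also have "\<dots> = a 0 + (R - a 0) * W" by (simp add: algebra_simps)
      finally show ?thesis using IH by linarith
    qed
    then show ?thesis using cS True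
      by (simp add: V_def sum.lessThan_Suc_shift del: sum.lessThan_Suc)
  qed
qed

text \<open>Raising \<open>m\<close> from \<open>l\<close> by one replaces
  \<open>(1 - \<alpha> * l / T) * (1 - \<alpha> / T)\<close> by
  \<open>1 - \<alpha> * (l + 1) / T\<close>, which is smaller by
  \<open>\<alpha>^2 * l / T^2\<close>.\<close>

lemma bound_G_mono:
  assumes "0 < \<alpha>" "\<alpha> \<le> 1" "m \<le> m'" "m' \<le> T"
  shows "bound_G T \<alpha> m \<le> bound_G T \<alpha> m'"
  using assms(3,4)
proof (induction m' rule: dec_induct)
  case base
  show ?case by simp
next
  case (step l)
  define q where "q = 1 - \<alpha> / real T"
  have T: "0 < T" using step by auto
  have q: "0 \<le> q" using assms T by (simp add: q_def field_simps)
  have "1 - \<alpha> * real (Suc l) / real T \<le> (1 - \<alpha> * real l / real T) * q"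
    using assms T by (simp add: q_def field_simps)
  then have "(1 - \<alpha> * real (Suc l) / real T) * q ^ (T - Suc l)
      \<le> ((1 - \<alpha> * real l / real T) * q) * q ^ (T - Suc l)"
    using q by (intro mult_right_mono) auto
  also have "\<dots> = (1 - \<alpha> * real l / real T) * q ^ (T - l)"
    using step by (simp add: Suc_diff_Suc flip: power_Suc)
  finally have "bound_G T \<alpha> l \<le> bound_G T \<alpha> (Suc l)"
    using assms(1) unfolding bound_G_def q_def
    by (intro mult_left_mono) auto
  then show ?case using step by simp
qed

section \<open>Submodular functions and the greedy algorithm\<close>

context
  fixes X :: "'a set" and f :: "'a set \<Rightarrow> real"
  assumes fin: "finite X" and ns: "nondecreasing_submodular X f"
begin

lemma f_mono: "S \<subseteq> R \<Longrightarrow> R \<subseteq> X \<Longrightarrow> f S \<le> f R"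
  using ns unfolding nondecreasing_submodular_def mono_on_def by auto

lemma f_empty: "f {} = 0"
  using ns unfolding nondecreasing_submodular_def by auto

lemma diminishing_returns:
  assumes "S \<subseteq> R" "R \<subseteq> X" "x \<in> X" "x \<notin> R"
  shows "f (insert x R) - f R \<le> f (insert x S) - f S"
proof -
  have "insert x S \<subseteq> X" using assms by auto
  then have "f (insert x S) + f R \<ge> f (insert x S \<union> R) + f (insert x S \<inter> R)"
    using ns assms(2) unfolding nondecreasing_submodular_def submodular_on_def by blast
  moreover have "insert x S \<union> R = insert x R" "insert x S \<inter> R = S" using assms by auto
  ultimately show ?thesis by simp
qed

text \<open>Add the elements of \<open>D\<close> one at a time; each gain is at most the gain over
  \<open>S\<close> alone.\<close>

lemma union_le_sum_marginals:
  assumes "D \<subseteq> X" "S \<subseteq> X" "D \<inter> S = {}"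
  shows "f (S \<union> D) \<le> f S + (\<Sum>x\<in>D. f (insert x S) - f S)"
proof -
  have "finite D" using finite_subset[OF assms(1) fin] .
  then show ?thesis using assms
  proof (induction D rule: finite_induct)
    case empty
    then show ?case by simp
  next
    case (insert x D)
    have "f (insert x (S \<union> D)) - f (S \<union> D) \<le> f (insert x S) - f S"
      using insert by (intro diminishing_returns) auto
    then show ?case using insert by simp
  qed
qed

text \<open>The curvature controls the top marginal \<open>f X - f (X - {x})\<close>, which is the
  smallest one of \<open>x\<close> by diminishing returns. Elements with \<open>f {x} = 0\<close>
  are excluded from the maximum; for them monotonicity suffices.\<close>

lemma curvature_marginal:
  assumes "S \<subseteq> X" "x \<in> X" "x \<notin> S"
  shows "(1 - total_curvature X f) * f {x} \<le> f (insert x S) - f S"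
proof (cases "f {x} = 0")
  case True
  then show ?thesis using f_mono[of S "insert x S"] assms by auto
next
  case False
  let ?C = "{1 - (f X - f (X - {x})) / (f {x} - f {}) | x. x \<in> X \<and> f {x} \<noteq> f {}}"
  have "?C \<subseteq> (\<lambda>x. 1 - (f X - f (X - {x})) / (f {x} - f {})) ` X" by auto
  then have "finite ?C" using fin finite_surj by blast
  moreover have "1 - (f X - f (X - {x})) / f {x} \<in> ?C"
    using False assms f_empty by auto
  ultimately have "1 - (f X - f (X - {x})) / f {x} \<le> total_curvature X f"
    unfolding total_curvature_def by (rule Max_ge)
  moreover have "0 < f {x}" using False f_mono[of "{}" "{x}"] assms f_empty by auto
  ultimately have "(1 - total_curvature X f) * f {x} \<le> f X - f (X - {x})"
    by (simp add: field_simps)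
  also have "\<dots> \<le> f (insert x S) - f S"
    using diminishing_returns[of S "X - {x}" x] assms insert_absorb[of x X] by auto
  finally show ?thesis .
qed

lemma singleton_pos: obtains x where "x \<in> X" "0 < f {x}"
proof -
  obtain S where S: "S \<subseteq> X" "f S \<noteq> 0" "0 \<le> f S"
    using ns unfolding nondecreasing_submodular_def by auto
  have "0 < (\<Sum>x\<in>S. f {x})" using union_le_sum_marginals[of S "{}"] S f_empty by simp
  then obtain x where "x \<in> S" "0 < f {x}" by (meson not_less sum_nonpos)
  then show ?thesis using that S by auto
qed

text \<open>A singleton of positive value extends to a feasible set. This justifies dividing by the
  optimum.\<close>

lemma optimal_value_pos:
  assumes "optimal_solution X f T S" "1 \<le> T" "T \<le> card X"
  shows "0 < f S"
proof -
  obtain x where x: "x \<in> X" "0 < f {x}" by (rule singleton_pos)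
  obtain R where R: "{x} \<subseteq> R" "R \<subseteq> X" "card R = T"
    using exists_subset_between[of "{x}" T X] assms x fin by auto
  have "f R \<le> f S" using assms(1) R unfolding optimal_solution_def is_arg_max_def by force
  then show ?thesis using f_mono[OF R(1,2)] x by simp
qed

end

section \<open>Runs of the greedy algorithm\<close>

text \<open>Recovers the order of the picks, which the inductive predicate hides: the state before
  step \<open>s\<close> is the image of \<open>{..<s}\<close> under \<open>x\<close>.\<close>

lemma greedy_solution_sequence:
  assumes "greedy_solution X f t S"
  obtains x where "S = x ` {..<t}"
    "\<And>s. s < t \<Longrightarrow> is_arg_max (\<lambda>y. f (insert y (x ` {..<s}))) (\<lambda>y. y \<in> X - x ` {..<s}) (x s)"
  using assms
proof (induction arbitrary: thesis rule: greedy_solution.induct)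
  case start
  then show ?case by auto
next
  case (step t S z)
  from step.IH obtain x where x: "S = x ` {..<t}"
    "\<And>s. s < t \<Longrightarrow> is_arg_max (\<lambda>y. f (insert y (x ` {..<s}))) (\<lambda>y. y \<in> X - x ` {..<s}) (x s)"
    by blast
  define x' where "x' = x(t := z)"
  have im: "x' ` {..<s} = x ` {..<s}" if "s \<le> t" for s
    using that by (intro image_cong) (auto simp: x'_def)
  show ?case
  proof (rule step.prems)
    show "S \<union> {z} = x' ` {..<Suc t}"
      using x(1) im[of t] by (auto simp: lessThan_Suc x'_def)
    show "is_arg_max (\<lambda>y. f (insert y (x' ` {..<s}))) (\<lambda>y. y \<in> X - x' ` {..<s}) (x' s)"
      if "s < Suc t" for s
    proof (cases "s = t")
      case True
      then show ?thesis using step.hyps(2) im[of t] x(1) by (simp add: x'_def)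
    next
      case False
      then show ?thesis using x(2)[of s] that im[of s] by (simp add: x'_def)
    qed
  qed
qed

lemma greedy_solution_subset: "greedy_solution X f t S \<Longrightarrow> S \<subseteq> X"
  by (induction rule: greedy_solution.induct) (auto simp: is_arg_max_def)

lemma greedy_solution_card:
  "greedy_solution X f t S \<Longrightarrow> finite S \<and> card S = t"
  by (induction rule: greedy_solution.induct) (auto simp: is_arg_max_def)

lemma greedy_solution_exists:
  assumes "finite X" "t \<le> card X"
  shows "\<exists>S. greedy_solution X f t S"
  using assms(2)
proof (induction t)
  case 0
  show ?case using greedy_solution.start by blast
next
  case (Suc t)
  then obtain S where S: "greedy_solution X f t S" by auto
  have "X - S \<noteq> {}"
    using greedy_solution_card[OF S] Suc.prems card_mono[of S X] by auto
  then obtain x where "is_arg_max (\<lambda>y. f (S \<union> {y})) (\<lambda>y. y \<in> X - S) x"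
    using assms(1) ex_is_arg_min_if_finite[of "X - S" "\<lambda>y. - f (S \<union> {y})"]
    by (auto simp: is_arg_min_def is_arg_max_def)
  then show ?case using greedy_solution.step[OF S] by blast
qed

text \<open>The gains of the run enter \<open>sum_ge_opt_ratio\<close> with
  \<open>N = k = T\<close>, \<open>R = f OPT\<close>, and \<open>P i\<close> meaning
  \<open>x i \<in> OPT\<close>.\<close>

lemma greedy_ge_bound_G:
  assumes fin: "finite X" and ns: "nondecreasing_submodular X f"
    and \<alpha>: "total_curvature X f = \<alpha>" "0 < \<alpha>" "\<alpha> \<le> 1"
    and OPT: "optimal_solution X f T OPT" and gr: "greedy_solution X f T S"
  shows "f OPT * bound_G T \<alpha> (card (OPT \<inter> S)) \<le> f S"
proof -
  note mono = f_mono[OF fin ns]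
  from gr obtain x where Sx: "S = x ` {..<T}" and
    gx: "\<And>s. s < T \<Longrightarrow> is_arg_max (\<lambda>y. f (insert y (x ` {..<s}))) (\<lambda>y. y \<in> X - x ` {..<s}) (x s)"
    by (rule greedy_solution_sequence) blast
  define Q where "Q t = x ` {..<t}" for t
  define a where "a t = f (Q (Suc t)) - f (Q t)" for t
  have QS: "Q (Suc t) = insert (x t) (Q t)" for t by (simp add: Q_def lessThan_Suc)
  have xX: "x t \<in> X" "x t \<notin> Q t" if "t < T" for t
    using gx[OF that] by (auto simp: is_arg_max_def Q_def)
  have xmax: "f (insert y (Q t)) - f (Q t) \<le> a t" if "t < T" "y \<in> X - Q t" for t y
    using gx[OF that(1)] that(2) by (force simp: is_arg_max_def Q_def a_def lessThan_Suc)
  have QX: "Q t \<subseteq> X" if "t \<le> T" for t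
    using xX that by (auto simp: Q_def)
  have inj: "inj_on x {..<T}"
  proof (rule linorder_inj_onI)
    show "x i \<noteq> x j" if "i < j" "j \<in> {..<T}" for i j
      using xX(2)[of j] that unfolding Q_def by (metis imageI lessThan_iff)
  qed auto
  have O: "OPT \<subseteq> X" "card OPT = T" using OPT by (auto simp: optimal_solution_def is_arg_max_def)
  have finO: "finite OPT" using O fin finite_subset by auto
  have a0: "0 \<le> a t" if "t < T" for t
    unfolding a_def using that QX[of "Suc t"] by (simp add: QS mono subset_insertI)
  have fQ: "f (Q t) = (\<Sum>i<t. a i)" for t
    by (induction t) (auto simp: a_def Q_def f_empty[OF fin ns])
  have cQ: "card (OPT \<inter> Q t) = card {i. i < t \<and> x i \<in> OPT}" if "t \<le> T" for t
  proof -
    have "OPT \<inter> Q t = x ` {i. i < t \<and> x i \<in> OPT}" by (auto simp: Q_def)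
    then show ?thesis using that by (simp add: card_image inj_on_subset[OF inj] subset_iff)
  qed
  \<comment> \<open>A pick in \<open>OPT\<close> leaves the union unchanged. Any other adds at least
    \<open>(1 - \<alpha>) * f {x t}\<close> by curvature, and \<open>f {x t}\<close> is at least its
    later gain \<open>a t\<close>.\<close>
  have lower: "f OPT + (\<Sum>i<t. if x i \<in> OPT then 0 else (1 - \<alpha>) * a i) \<le> f (OPT \<union> Q t)"
    if "t \<le> T" for t
    using that
  proof (induction t)
    case 0
    then show ?case by (simp add: Q_def)
  next
    case (Suc t)
    have U: "OPT \<union> Q t \<subseteq> X" using O QX Suc.prems by auto
    show ?case
    proof (cases "x t \<in> OPT")
      case True
      then show ?thesis using Suc by (simp add: QS insert_absorb)
    next
      case False
      have "a t \<le> f {x t}"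
        using diminishing_returns[OF fin ns, of "{}" "Q t" "x t"] xX[of t] QX[of t] Suc.prems
        by (simp add: a_def QS f_empty[OF fin ns])
      then have "(1 - \<alpha>) * a t \<le> (1 - \<alpha>) * f {x t}"
        using \<alpha> by (intro mult_left_mono) auto
      also have "\<dots> \<le> f (insert (x t) (OPT \<union> Q t)) - f (OPT \<union> Q t)"
        using curvature_marginal[OF fin ns U, of "x t"] xX[of t] False Suc.prems \<alpha>(1) by simp
      finally show ?thesis using Suc False by (simp add: QS)
    qed
  qed
  \<comment> \<open>Each missing element of \<open>OPT\<close> was a candidate at step
    \<open>t\<close>, so its marginal over \<open>Q t\<close> is at most \<open>a t\<close>.\<close>
  have upper: "f (OPT \<union> Q t) \<le> f (Q t) + (real T - real (card (OPT \<inter> Q t))) * a t"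
    if "t < T" for t
  proof -
    have "f (Q t \<union> (OPT - Q t)) \<le> f (Q t) + (\<Sum>y\<in>OPT - Q t. f (insert y (Q t)) - f (Q t))"
      using O QX[of t] that by (intro union_le_sum_marginals[OF fin ns]) auto
    also have "(\<Sum>y\<in>OPT - Q t. f (insert y (Q t)) - f (Q t)) \<le> real (card (OPT - Q t)) * a t"
      using xmax[OF that] O by (intro sum_bounded_above) auto
    also have "real (card (OPT - Q t)) = real T - real (card (OPT \<inter> Q t))"
      using card_Diff_subset_Int[of OPT "Q t"] finO O(2) card_mono[of OPT "OPT \<inter> Q t"]
      by simp
    finally show ?thesis by (simp add: Un_commute)
  qed
  have constraint: "f OPT \<le> (\<Sum>i<t. if x i \<in> OPT then a i else \<alpha> * a i)
      + (real T - real (card {i. i < t \<and> x i \<in> OPT})) * a t" if "t < T" for t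
  proof -
    have "(\<Sum>i<t. if x i \<in> OPT then a i else \<alpha> * a i)
        = (\<Sum>i<t. a i) - (\<Sum>i<t. if x i \<in> OPT then 0 else (1 - \<alpha>) * a i)"
      unfolding sum_subtractf[symmetric] by (intro sum.cong) (auto simp: algebra_simps)
    then show ?thesis using lower[of t] upper[of t] cQ[of t] that by (simp add: fQ)
  qed
  have "f OPT * opt_ratio \<alpha> T (T - card {i. i < T \<and> x i \<in> OPT}) (card {i. i < T \<and> x i \<in> OPT})
      \<le> (\<Sum>i<T. a i)"
    using a0 constraint by (intro sum_ge_opt_ratio \<alpha>) auto
  moreover have "S = Q T" by (simp add: Sx Q_def)
  ultimately show ?thesis using cQ[of T] fQ[of T] by (simp add: bound_G_eq_opt_ratio)
qed

section \<open>The extremal functions\<close>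

text \<open>With \<open>A\<close> and \<open>B\<close> the two sums and \<alpha> nonzero, this is
  \<open>(1 - (1 - \<alpha> * A) * (1 - \<alpha> * B)) / \<alpha>\<close>, the shape of
  \<open>bound_G\<close>.\<close>

definition bilinear_fun :: "real \<Rightarrow> ('a \<Rightarrow> real) \<Rightarrow> ('a \<Rightarrow> real) \<Rightarrow> 'a set \<Rightarrow> real" where
  "bilinear_fun \<alpha> a b S = sum a S + sum b S - \<alpha> * sum a S * sum b S"

lemma bilinear_fun_insert:
  assumes "finite S" "x \<notin> S" "a x * b x = 0"
  shows "bilinear_fun \<alpha> a b (insert x S)
    = bilinear_fun \<alpha> a b S + a x * (1 - \<alpha> * sum b S) + b x * (1 - \<alpha> * sum a S)"
  using assms by (auto simp: bilinear_fun_def algebra_simps)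

context
  fixes X :: "'a set" and a b :: "'a \<Rightarrow> real" and \<alpha> :: real
  assumes fin: "finite X" and \<alpha>: "0 < \<alpha>" "\<alpha> \<le> 1"
    and nonneg: "\<And>x. 0 \<le> a x" "\<And>x. 0 \<le> b x" and disj: "\<And>x. a x * b x = 0"
    and sums: "sum a X \<le> 1" "sum b X = 1"
    and nz: "\<exists>x\<in>X. a x \<noteq> 0"
begin

lemma partial_sum_bounds:
  assumes "S \<subseteq> X"
  shows "0 \<le> sum a S" "0 \<le> sum b S" "\<alpha> * sum a S \<le> 1" "\<alpha> * sum b S \<le> 1"
proof -
  show 0: "0 \<le> sum a S" "0 \<le> sum b S" using nonneg by (auto intro: sum_nonneg)
  have "sum a S \<le> 1" "sum b S \<le> 1"
    using sum_mono2[of X S a] sum_mono2[of X S b] fin assms nonneg sums by auto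
  then show "\<alpha> * sum a S \<le> 1" "\<alpha> * sum b S \<le> 1" using 0 \<alpha> by (auto intro: mult_le_one)
qed

lemma bilinear_fun_mono:
  assumes "S \<subseteq> R" "R \<subseteq> X"
  shows "bilinear_fun \<alpha> a b S \<le> bilinear_fun \<alpha> a b R"
proof -
  have "finite R" using assms fin finite_subset by auto
  then have "sum a S \<le> sum a R" "sum b S \<le> sum b R"
    using assms nonneg by (auto intro: sum_mono2)
  moreover have "\<alpha> * sum b R \<le> 1" "\<alpha> * sum a S \<le> 1"
    using partial_sum_bounds assms by auto
  \<comment> \<open>The right side is exactly the difference of the two values.\<close>
  ultimately have "0 \<le> (sum a R - sum a S) * (1 - \<alpha> * sum b R) + (sum b R - sum b S) * (1 - \<alpha> * sum a S)"
    by simp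
  then show ?thesis by (simp add: bilinear_fun_def algebra_simps)
qed

lemma bilinear_fun_nondecreasing_submodular:
  "nondecreasing_submodular X (bilinear_fun \<alpha> a b)"
proof -
  let ?f = "bilinear_fun \<alpha> a b"
  have e: "?f {} = 0" by (simp add: bilinear_fun_def)
  have "?f (S \<union> R) + ?f (S \<inter> R) \<le> ?f S + ?f R" if SR: "S \<subseteq> X" "R \<subseteq> X" for S R
  proof -
    have fi: "finite S" "finite R" using SR fin finite_subset by auto
    have dec: "sum g S = sum g (S \<inter> R) + sum g (S - R)" "sum g R = sum g (S \<inter> R) + sum g (R - S)"
      "sum g (S \<union> R) = sum g (S \<inter> R) + sum g (S - R) + sum g (R - S)" for g :: "'a \<Rightarrow> real"
      using fi sum.Int_Diff[of S g R] sum.Int_Diff[of R g S] sum.union_inter[of S R g]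
      by (simp_all add: Int_commute)
    \<comment> \<open>This is the exact gap in the submodularity inequality; the modular parts
      cancel.\<close>
    have "0 \<le> \<alpha> * (sum a (S - R) * sum b (R - S) + sum a (R - S) * sum b (S - R))"
      using \<alpha> nonneg by (intro mult_nonneg_nonneg add_nonneg_nonneg sum_nonneg) auto
    then show ?thesis unfolding bilinear_fun_def dec by (simp add: algebra_simps)
  qed
  moreover have "?f X \<noteq> 0"
  proof -
    obtain x where x: "x \<in> X" "a x \<noteq> 0" using nz by auto
    then have "?f {x} \<noteq> 0" "0 \<le> ?f {x}" using disj[of x] nonneg by (auto simp: bilinear_fun_def)
    then show ?thesis using bilinear_fun_mono[of "{x}" X] x by auto
  qed
  ultimately show ?thesis
    using e bilinear_fun_mono bilinear_fun_mono[of "{}"]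
    unfolding nondecreasing_submodular_def submodular_on_def mono_on_def by auto
qed

text \<open>An element with positive \<open>a\<close> attains \<alpha> because
  \<open>sum b X = 1\<close>; one with positive \<open>b\<close> has ratio
  \<open>\<alpha> * sum a X\<close>, which is at most \<alpha>.\<close>

lemma bilinear_fun_curvature: "total_curvature X (bilinear_fun \<alpha> a b) = \<alpha>"
proof -
  let ?f = "bilinear_fun \<alpha> a b"
  let ?r = "\<lambda>x. 1 - (?f X - ?f (X - {x})) / (?f {x} - ?f {})"
  have e: "?f {} = 0" by (simp add: bilinear_fun_def)
  have s: "?f {x} = a x + b x" for x using disj[of x] by (simp add: bilinear_fun_def)
  have top: "?f X - ?f (X - {x}) = a x * (1 - \<alpha>) + b x * (1 - \<alpha> * sum a X)" if "x \<in> X" for x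
  proof -
    have "?f X - ?f (X - {x}) = a x * (1 - \<alpha> * sum b (X - {x})) + b x * (1 - \<alpha> * sum a (X - {x}))"
      using bilinear_fun_insert[of "X - {x}" x a b \<alpha>] disj fin that by (simp add: insert_absorb)
    also have "\<dots> = a x * (1 - \<alpha>) + b x * (1 - \<alpha> * sum a X)"
      using fin that sums(2) disj[of x] by (auto simp: sum_diff1)
    finally show ?thesis .
  qed
  have ra: "?r x = \<alpha>" if "x \<in> X" "a x \<noteq> 0" for x
    using that disj[of x] top[of x] s[of x] e by (simp add: field_simps)
  have rb: "?r x \<le> \<alpha>" if "x \<in> X" "?f {x} \<noteq> 0" for x
  proof (cases "a x = 0")
    case True
    then have "?r x = \<alpha> * sum a X" using that top[of x] s[of x] e by simp
    then show ?thesis using sums \<alpha> by simp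
  next
    case False
    then show ?thesis using ra that by auto
  qed
  obtain x where x: "x \<in> X" "a x \<noteq> 0" using nz by auto
  show ?thesis unfolding total_curvature_def
  proof (rule Max_eqI)
    show "finite {?r x |x. x \<in> X \<and> ?f {x} \<noteq> ?f {}}" using fin by simp
    show "y \<le> \<alpha>" if "y \<in> {?r x |x. x \<in> X \<and> ?f {x} \<noteq> ?f {}}" for y
      using that rb e by auto
    have "?f {x} \<noteq> ?f {}" using x s[of x] e disj[of x] by auto
    then show "\<alpha> \<in> {?r x |x. x \<in> X \<and> ?f {x} \<noteq> ?f {}}" using x ra[OF x] by force
  qed
qed

end

section \<open>The extremal instance\<close>

text \<open>In the extremal instance on \<open>{..<n}\<close> with budget \<open>T\<close>, the optimal set is \<open>{k..<k + T}\<close> with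
  \<open>k = min T (n - T)\<close>, the greedy algorithm picks \<open>0, 1, \<dots>, T - 1\<close> in this order, and the
  elements from \<open>k + T\<close> on have value \<open>0\<close>.\<close>

definition greedy_weight :: "real \<Rightarrow> nat \<Rightarrow> nat \<Rightarrow> nat \<Rightarrow> real" where
  "greedy_weight \<alpha> T k i = (if i < k then (1 - \<alpha> / real T) ^ i / real T else 0)"

definition opt_weight :: "nat \<Rightarrow> nat \<Rightarrow> nat \<Rightarrow> real" where
  "opt_weight T k i = (if k \<le> i \<and> i < k + T then 1 / real T else 0)"

context
  fixes \<alpha> :: real and n T k :: nat and f :: "nat set \<Rightarrow> real"
  assumes \<alpha>: "0 < \<alpha>" "\<alpha> \<le> 1" and T: "0 < T" and k: "0 < k" "k \<le> T" "k + T \<le> n"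
  defines "f \<equiv> bilinear_fun \<alpha> (greedy_weight \<alpha> T k) (opt_weight T k)"
begin

lemma ratio_bounds: "0 \<le> 1 - \<alpha> / real T" "1 - \<alpha> / real T \<le> 1"
  using \<alpha> T by (auto simp: field_simps)

lemma weight_nonneg: "0 \<le> greedy_weight \<alpha> T k i" "0 \<le> opt_weight T k i"
  using ratio_bounds by (auto simp: greedy_weight_def opt_weight_def)

lemma weight_disjoint: "greedy_weight \<alpha> T k i * opt_weight T k i = 0"
  by (simp add: greedy_weight_def opt_weight_def)

text \<open>This caps every set of \<open>T\<close> elements at value 1, which the optimal set
  reaches.\<close>

lemma weight_le: "greedy_weight \<alpha> T k i + opt_weight T k i \<le> 1 / real T"
  using ratio_bounds T
  by (auto simp: greedy_weight_def opt_weight_def intro!: divide_right_mono power_le_one)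

text \<open>A geometric series; \<open>1 - \<alpha> * A\<close> is the factor by which
  \<open>t\<close> greedy picks shrink the marginals of the optimal elements.\<close>

lemma sum_greedy_weight: "t \<le> k \<Longrightarrow> \<alpha> * (\<Sum>i<t. greedy_weight \<alpha> T k i) = 1 - (1 - \<alpha> / real T) ^ t"
  by (induction t) (auto simp: greedy_weight_def algebra_simps)

lemma sum_greedy_weight_ge:
  assumes "k \<le> t" shows "(\<Sum>i<t. greedy_weight \<alpha> T k i) = (\<Sum>i<k. greedy_weight \<alpha> T k i)"
  using assms by (intro sum.mono_neutral_right) (auto simp: greedy_weight_def)

lemma sum_opt_weight:
  assumes "finite S"
  shows "sum (opt_weight T k) S = real (card (S \<inter> {k..<k + T})) / real T"
proof -
  have "sum (opt_weight T k) S = (\<Sum>i\<in>S \<inter> {k..<k + T}. 1 / real T)"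
    using assms by (intro sum.mono_neutral_cong_right) (auto simp: opt_weight_def)
  then show ?thesis by simp
qed

lemma sum_opt_weight_all: "{k..<k + T} \<subseteq> S \<Longrightarrow> finite S \<Longrightarrow> sum (opt_weight T k) S = 1"
  using T by (simp add: sum_opt_weight Int_absorb1)

lemma extremal_instance:
  shows "nondecreasing_submodular {..<n} f" "total_curvature {..<n} f = \<alpha>"
proof -
  have "(\<Sum>i<k. greedy_weight \<alpha> T k i) \<le> real (card {..<k}) * (1 / real T)"
    using weight_le weight_nonneg(2) by (intro sum_bounded_above) (smt (verit))
  also have "\<dots> \<le> 1" using k T by simp
  finally have A: "(\<Sum>i<n. greedy_weight \<alpha> T k i) \<le> 1"
    using k sum_greedy_weight_ge[of n] by simp
  have B: "(\<Sum>i<n. opt_weight T k i) = 1" using k by (intro sum_opt_weight_all) auto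
  have nz: "\<exists>x\<in>{..<n}. greedy_weight \<alpha> T k x \<noteq> 0"
    using k T by (intro bexI[of _ 0]) (auto simp: greedy_weight_def)
  show "nondecreasing_submodular {..<n} f" "total_curvature {..<n} f = \<alpha>"
    unfolding f_def using \<alpha> weight_nonneg weight_disjoint A B nz
    by (intro bilinear_fun_nondecreasing_submodular bilinear_fun_curvature; simp)+
qed

lemma extremal_optimal:
  "f {k..<k + T} = 1" "optimal_solution {..<n} f T {k..<k + T}"
proof -
  have 0: "sum (greedy_weight \<alpha> T k) {k..<k + T} = 0"
    by (intro sum.neutral) (auto simp: greedy_weight_def)
  show 1: "f {k..<k + T} = 1"
    unfolding f_def bilinear_fun_def 0 by (simp add: sum_opt_weight_all)
  have "f R \<le> 1" if "R \<subseteq> {..<n}" "card R = T" for R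
  proof -
    have "f R \<le> (\<Sum>i\<in>R. greedy_weight \<alpha> T k i + opt_weight T k i)"
      unfolding f_def bilinear_fun_def sum.distrib using \<alpha> weight_nonneg
      by (auto intro!: mult_nonneg_nonneg sum_nonneg)
    also have "\<dots> \<le> real (card R) * (1 / real T)"
      using weight_le by (intro sum_bounded_above) auto
    finally show ?thesis using that T by simp
  qed
  then show "optimal_solution {..<n} f T {k..<k + T}"
    unfolding optimal_solution_def is_arg_max_def 1 using k by (auto simp: not_less)
qed

lemma extremal_greedy: "t \<le> T \<Longrightarrow> greedy_solution {..<n} f t {..<t}"
proof (induction t)
  case 0
  then show ?case using greedy_solution.start by simp
next
  case (Suc t)
  define A where "A = (\<Sum>i<t. greedy_weight \<alpha> T k i)"
  define B where "B = (\<Sum>i<t. opt_weight T k i)"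
  have f: "f ({..<t} \<union> {y}) = f {..<t} + greedy_weight \<alpha> T k y * (1 - \<alpha> * B)
      + opt_weight T k y * (1 - \<alpha> * A)" if "t \<le> y" for y
    unfolding f_def A_def B_def using that weight_disjoint by (simp add: bilinear_fun_insert)
  have le: "f ({..<t} \<union> {y}) \<le> f ({..<t} \<union> {t})" if y: "t \<le> y" for y
  proof (cases "t < k")
    case True
    \<comment> \<open>The tie: \<open>t\<close> and every optimal element gain exactly
      \<open>?q ^ t / T\<close>, the latter because
      \<open>1 - \<alpha> * A = ?q ^ t\<close>.\<close>
    let ?q = "1 - \<alpha> / real T"
    have B: "B = 0" using True unfolding B_def by (intro sum.neutral) (auto simp: opt_weight_def)
    have A: "1 - \<alpha> * A = ?q ^ t" using sum_greedy_weight[of t] True unfolding A_def by simp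
    have "greedy_weight \<alpha> T k y + opt_weight T k y * ?q ^ t \<le> ?q ^ t / real T"
      using ratio_bounds y
      by (auto simp: greedy_weight_def opt_weight_def intro!: divide_right_mono power_decreasing)
    moreover have "greedy_weight \<alpha> T k t + opt_weight T k t * ?q ^ t = ?q ^ t / real T"
      using True by (simp add: greedy_weight_def opt_weight_def)
    ultimately show ?thesis using f[of t] f[OF y] A B by simp
  next
    case False
    \<comment> \<open>From \<open>k\<close> on only optimal elements carry weight, all the same, and
      \<open>t < T\<close> keeps \<open>t\<close> among them.\<close>
    have "\<alpha> * A = 1 - (1 - \<alpha> / real T) ^ k"
      using sum_greedy_weight[of k] sum_greedy_weight_ge[of t] False unfolding A_def by simp
    then have "0 \<le> 1 - \<alpha> * A" using ratio_bounds by simp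
    then have "opt_weight T k y * (1 - \<alpha> * A) \<le> opt_weight T k t * (1 - \<alpha> * A)"
      using False Suc.prems by (intro mult_right_mono) (auto simp: opt_weight_def)
    then show ?thesis using f[of t] f[OF y] False y by (simp add: greedy_weight_def)
  qed
  have "is_arg_max (\<lambda>y. f ({..<t} \<union> {y})) (\<lambda>y. y \<in> {..<n} - {..<t}) t"
    unfolding is_arg_max_def using le Suc.prems k by force
  from greedy_solution.step[OF Suc.IH this] Suc.prems show ?case
    by (simp add: lessThan_Suc)
qed

text \<open>In the product form of \<open>bilinear_fun\<close>, the factors are
  \<open>(1 - \<alpha> / T) ^ k\<close> and \<open>1 - \<alpha> * (T - k) / T\<close>, those of
  \<open>bound_G\<close> for \<open>m = T - k\<close>.\<close>

lemma extremal_greedy_value: "f {..<T} = bound_G T \<alpha> (T - k)"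
proof -
  have "{..<T} \<inter> {k..<k + T} = {k..<T}" by auto
  then have B: "(\<Sum>i<T. opt_weight T k i) = real (T - k) / real T"
    by (simp add: sum_opt_weight)
  define A where "A = (\<Sum>i<T. greedy_weight \<alpha> T k i)"
  have "\<alpha> * A = 1 - (1 - \<alpha> / real T) ^ k"
    using sum_greedy_weight[of k] sum_greedy_weight_ge[of T] k unfolding A_def by simp
  then have A: "A = 1 / \<alpha> * (1 - (1 - \<alpha> / real T) ^ k)" using \<alpha> by (simp add: field_simps)
  have "f {..<T} = A + real (T - k) / real T - \<alpha> * A * (real (T - k) / real T)"
    unfolding f_def bilinear_fun_def B A_def by simp
  also have "\<dots> = bound_G T \<alpha> (T - k)"
    unfolding A bound_G_def using \<alpha> k by (simp add: field_simps)
  finally show ?thesis .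
qed

end

section \<open>Tightness and conclusion\<close>

lemma bound_G_tilde_attained:
  fixes \<alpha> :: real
  assumes \<alpha>: "0 < \<alpha>" "\<alpha> \<le> 1" and n: "2 \<le> n" and T: "1 \<le> T" "T \<le> n"
  shows "\<exists>(X :: nat set) f S_opt S_gr. finite X \<and> card X = n \<and> nondecreasing_submodular X f \<and>
    total_curvature X f = \<alpha> \<and> optimal_solution X f T S_opt \<and> greedy_solution X f T S_gr \<and>
    card (S_opt \<inter> S_gr) = 2 * T - n \<and> f S_gr / f S_opt = bound_G_tilde T \<alpha> n"
proof (cases "T = n")
  case True
  \<comment> \<open>Here \<open>min T (n - T)\<close> is 0, so no element would carry the weight
    that attains the curvature. As the whole set is the only feasible one and the bound is 1, any
    instance of curvature \<alpha> works, such as this one on two elements padded with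
    zeros.\<close>
  define f where "f = bilinear_fun \<alpha> (greedy_weight \<alpha> 1 1) (opt_weight 1 1)"
  have f: "nondecreasing_submodular {..<n} f" "total_curvature {..<n} f = \<alpha>"
    unfolding f_def using extremal_instance[of \<alpha> 1 1 n] \<alpha> n by auto
  obtain S where S: "greedy_solution {..<n} f n S"
    using greedy_solution_exists[of "{..<n}" n f] by auto
  have SX: "S = {..<n}"
    using greedy_solution_subset[OF S] greedy_solution_card[OF S] by (intro card_subset_eq) auto
  have opt: "optimal_solution {..<n} f n {..<n}"
    unfolding optimal_solution_def is_arg_max_def
    using f_mono[OF _ f(1)] by (auto simp: not_less)
  have "0 < f {..<n}" using optimal_value_pos[OF _ f(1) opt] n by simp
  moreover have "bound_G_tilde n \<alpha> n = 1" using \<alpha> n by (simp add: bound_G_tilde_def bound_G_def)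
  ultimately show ?thesis
    using True f S opt unfolding SX
    by (intro exI[of _ "{..<n}"] exI[of _ f]) auto
next
  case False
  \<comment> \<open>The number of greedy picks outside the optimum, limited by the budget and by the
    \<open>n - T\<close> elements there.\<close>
  define k where "k = min T (n - T)"
  define f where "f = bilinear_fun \<alpha> (greedy_weight \<alpha> T k) (opt_weight T k)"
  have k: "0 < k" "k \<le> T" "k + T \<le> n" "0 < T" "T - k = 2 * T - n"
    using False T by (auto simp: k_def)
  have "{k..<k + T} \<inter> {..<T} = {k..<T}" by auto
  then have "card ({k..<k + T} \<inter> {..<T}) = 2 * T - n" using k by simp
  moreover have "f {..<T} / f {k..<k + T} = bound_G_tilde T \<alpha> n"
    using extremal_greedy_value[OF \<alpha> k(4,1-3)] extremal_optimal(1)[OF \<alpha> k(4,1-3)]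
    by (simp add: f_def bound_G_tilde_def k(5))
  ultimately show ?thesis
    using extremal_instance[OF \<alpha> k(4,1-3)] extremal_optimal(2)[OF \<alpha> k(4,1-3)]
      extremal_greedy[OF \<alpha> k(4,1-3) order_refl]
    unfolding f_def[symmetric]
    by (intro exI[of _ "{..<n}"] exI[of _ f] exI[of _ "{k..<k + T}"] exI[of _ "{..<T}"]) auto
qed

theorem theorem1:
  "(\<forall>(X :: 'a set) (f :: 'a set \<Rightarrow> real) (n :: nat) (T :: nat) (\<alpha> :: real) S_opt S_gr (m :: nat).
      finite X \<longrightarrow> card X = n \<longrightarrow> 1 \<le> T \<longrightarrow> T \<le> n \<longrightarrow>
      nondecreasing_submodular X f \<longrightarrow>
      total_curvature X f = \<alpha> \<longrightarrow> 0 < \<alpha> \<longrightarrow> \<alpha> \<le> 1 \<longrightarrow>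
      optimal_solution X f T S_opt \<longrightarrow> greedy_solution X f T S_gr \<longrightarrow>
      m = card (S_opt \<inter> S_gr) \<longrightarrow>
      f S_gr / f S_opt \<ge> bound_G T \<alpha> m \<and> bound_G T \<alpha> m \<ge> bound_G_tilde T \<alpha> n) \<and>
   (\<forall>(\<alpha> :: real) (n :: nat) (T :: nat).
      0 < \<alpha> \<longrightarrow> \<alpha> \<le> 1 \<longrightarrow> 2 \<le> n \<longrightarrow> 1 \<le> T \<longrightarrow> T \<le> n \<longrightarrow>
      (\<exists>(X :: nat set) (f :: nat set \<Rightarrow> real) S_opt S_gr.
         finite X \<and> card X = n \<and>
         nondecreasing_submodular X f \<and>
         total_curvature X f = \<alpha> \<and>
         optimal_solution X f T S_opt \<and> greedy_solution X f T S_gr \<and>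
         card (S_opt \<inter> S_gr) = 2 * T - n \<and>
         f S_gr / f S_opt = bound_G_tilde T \<alpha> n))"
proof (intro conjI allI impI)
  fix X :: "'a set" and f n T \<alpha> S_opt S_gr m
  assume *: "finite X" "card X = n" "1 \<le> T" "T \<le> n" "nondecreasing_submodular X f"
    "total_curvature X f = \<alpha>" "0 < \<alpha>" "\<alpha> \<le> 1" "optimal_solution X f T S_opt"
    "greedy_solution X f T S_gr" "m = card (S_opt \<inter> S_gr)"
  show "bound_G T \<alpha> m \<le> f S_gr / f S_opt"
    using greedy_ge_bound_G[of X f \<alpha> T S_opt S_gr] optimal_value_pos[of X f T S_opt] *
    by (simp add: field_simps)
  have S: "S_opt \<subseteq> X" "card S_opt = T" "finite S_opt"
    using * finite_subset by (auto simp: optimal_solution_def is_arg_max_def)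
  have G: "S_gr \<subseteq> X" "card S_gr = T" "finite S_gr"
    using *(10) greedy_solution_subset greedy_solution_card by blast+
  \<comment> \<open>By inclusion-exclusion the union has \<open>2 * T - m\<close> elements.\<close>
  have "card (S_opt \<union> S_gr) \<le> n" using S G * card_mono[of X "S_opt \<union> S_gr"] by simp
  then have "2 * T - n \<le> m" using card_Un_Int[of S_opt S_gr] S G * by simp
  moreover have "m \<le> T" using S * card_mono[of S_opt "S_opt \<inter> S_gr"] by simp
  ultimately show "bound_G_tilde T \<alpha> n \<le> bound_G T \<alpha> m"
    unfolding bound_G_tilde_def using * by (intro bound_G_mono) auto
next
  fix \<alpha> :: real and n T :: nat
  assume "0 < \<alpha>" "\<alpha> \<le> 1" "2 \<le> n" "1 \<le> T" "T \<le> n"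
  then show "\<exists>(X :: nat set) f S_opt S_gr. finite X \<and> card X = n \<and> nondecreasing_submodular X f \<and>
    total_curvature X f = \<alpha> \<and> optimal_solution X f T S_opt \<and> greedy_solution X f T S_gr \<and>
    card (S_opt \<inter> S_gr) = 2 * T - n \<and> f S_gr / f S_opt = bound_G_tilde T \<alpha> n"
    by (rule bound_G_tilde_attained)
qed

end
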